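(* Let $(W,S)$ be a Coxeter system and let $W_I$ ($I\subset S$) be a standard parabolic subgroup of $W$. If $H\subset W_I$ is a quasiparabolic subgroup of $W_I$, then $H$ is also quasiparabolic as a subgroup of $W$. In particular, $W_I$ and its even subgroup $\{w\in W_I:\ell(w)\text{ even}\}$ are quasiparabolic in $W$.
   Context: Coxeter systems $(W,S)$ have finite rank; $R(W)$ is the set of reflections, i.e. conjugates in $W$ of elements of $S$; $\ell$ is the length function. The standard parabolic subgroup $W_I$ is the subgroup generated by $I\subset S$, with Coxeter system $(W_I,I)$. A scaled $W$-set is a pair $(X,\mathrm{ht})$ with $X$ a (left) $W$-set and $\mathrm{ht}:X\to\mathbb Z$ a function with $|\mathrm{ht}(sx)-\mathrm{ht}(x)|\le 1$ for all $s\in S$, $x\in X$. A quasiparabolic $W$-set is a scaled $W$-set such that (QP1) for all $r\in R(W)$, $x\in X$, if $\mathrm{ht}(rx)=\mathrm{ht}(x)$ then $rx=x$; and (QP2) for all $r\in R(W)$, $x\in X$, $s\in S$, if $\mathrm{ht}(rx)>\mathrm{ht}(x)$ and $\mathrm{ht}(srx)<\mathrm{ht}(sx)$, then $rx=sx$. A subgroup $H\subset W$ is quasiparabolic if the set of left cosets $W/H$ with height $\mathrm{ht}(wH)=\min_{v\in wH}\ell(v)$ is a quasiparabolic $W$-set. *)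

theory Defs
  imports "HOL-Algebra.Group_Action" "HOL-Algebra.Left_Coset" "HOL-Algebra.Generated_Groups"
begin

section \<open>Group presentations\<close>

text \<open>
  A signed word over \<open>S\<close> is a list of letters \<open>(s, b)\<close> with \<open>s \<in> S\<close>; \<open>(s, True)\<close> stands for \<open>s\<close>
  and \<open>(s, False)\<close> for the formal inverse of \<open>s\<close>. Two words are related by \<open>pres_eq S R\<close> iff they
  represent the same element of the group presented by generators \<open>S\<close> and relators \<open>R\<close>, that is,
  of the free group on \<open>S\<close> modulo the normal closure of \<open>R\<close>.
\<close>

abbreviation signed_words :: "'a set \<Rightarrow> ('a \<times> bool) list set" where
  "signed_words S \<equiv> lists (S \<times> UNIV)"

inductive pres_eq :: "'a set \<Rightarrow> ('a \<times> bool) list set \<Rightarrow>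
    ('a \<times> bool) list \<Rightarrow> ('a \<times> bool) list \<Rightarrow> bool"
  for S :: "'a set" and R :: "('a \<times> bool) list set"
where
  refl: "u \<in> signed_words S \<Longrightarrow> pres_eq S R u u"
| sym: "pres_eq S R u v \<Longrightarrow> pres_eq S R v u"
| trans: "pres_eq S R u v \<Longrightarrow> pres_eq S R v w \<Longrightarrow> pres_eq S R u w"
| cancel: "u \<in> signed_words S \<Longrightarrow> v \<in> signed_words S \<Longrightarrow> s \<in> S \<Longrightarrow>
    pres_eq S R (u @ [(s, b), (s, \<not> b)] @ v) (u @ v)"
| relator: "u \<in> signed_words S \<Longrightarrow> v \<in> signed_words S \<Longrightarrow> r \<in> R \<Longrightarrow>
    pres_eq S R (u @ r @ v) (u @ v)"

definition signed_word_val :: "('a, 'b) monoid_scheme \<Rightarrow> ('a \<times> bool) list \<Rightarrow> 'a" where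
  "signed_word_val W u =
    foldr (\<lambda>(s, b) w. (if b then s else inv\<^bsub>W\<^esub> s) \<otimes>\<^bsub>W\<^esub> w) u \<one>\<^bsub>W\<^esub>"

definition presented_by ::
  "('a, 'b) monoid_scheme \<Rightarrow> 'a set \<Rightarrow> ('a \<times> bool) list set \<Rightarrow> bool"
where
  "presented_by W S R \<longleftrightarrow>
     S \<subseteq> carrier W \<and> generate W S = carrier W \<and>
     (\<forall>u\<in>signed_words S. \<forall>v\<in>signed_words S.
        signed_word_val W u = signed_word_val W v \<longleftrightarrow> pres_eq S R u v)"


section \<open>Coxeter systems\<close>

text \<open>
  A Coxeter matrix over \<open>S\<close>; the entry \<open>0\<close> encodes \<open>\<infinity>\<close>, so off-diagonal entries range over
  \<open>{2, 3, \<dots>} \<union> {\<infinity>}\<close>.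
\<close>

definition coxeter_matrix_on :: "'a set \<Rightarrow> ('a \<Rightarrow> 'a \<Rightarrow> nat) \<Rightarrow> bool" where
  "coxeter_matrix_on S m \<longleftrightarrow>
     (\<forall>s\<in>S. m s s = 1) \<and>
     (\<forall>s\<in>S. \<forall>t\<in>S. m s t = m t s) \<and>
     (\<forall>s\<in>S. \<forall>t\<in>S. s \<noteq> t \<longrightarrow> m s t \<noteq> 1)"

text \<open>
  The relators \<open>(s t)^m(s,t)\<close>. For \<open>m s t = 0\<close>, i.e. \<open>\<infinity>\<close>, the relator is the empty word and so
  imposes no relation.
\<close>

definition coxeter_relators :: "'a set \<Rightarrow> ('a \<Rightarrow> 'a \<Rightarrow> nat) \<Rightarrow> ('a \<times> bool) list set" where
  "coxeter_relators S m =
     {concat (replicate (m s t) [(s, True), (t, True)]) | s t. s \<in> S \<and> t \<in> S}"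

text \<open>Coxeter systems are of finite rank throughout.\<close>

definition coxeter_system :: "('a, 'b) monoid_scheme \<Rightarrow> 'a set \<Rightarrow> bool" where
  "coxeter_system W S \<longleftrightarrow>
     group W \<and> finite S \<and>
     (\<exists>m. coxeter_matrix_on S m \<and> presented_by W S (coxeter_relators S m))"

definition cox_length :: "('a, 'b) monoid_scheme \<Rightarrow> 'a set \<Rightarrow> 'a \<Rightarrow> nat" where
  "cox_length W S w =
     (LEAST n. \<exists>ss\<in>lists S. length ss = n \<and> foldr (\<otimes>\<^bsub>W\<^esub>) ss \<one>\<^bsub>W\<^esub> = w)"

definition reflections :: "('a, 'b) monoid_scheme \<Rightarrow> 'a set \<Rightarrow> 'a set" where
  "reflections W S = {w \<otimes>\<^bsub>W\<^esub> s \<otimes>\<^bsub>W\<^esub> inv\<^bsub>W\<^esub> w | w s. w \<in> carrier W \<and> s \<in> S}"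

definition std_parabolic :: "('a, 'b) monoid_scheme \<Rightarrow> 'a set \<Rightarrow> ('a, 'b) monoid_scheme" where
  "std_parabolic W I = W\<lparr>carrier := generate W I\<rparr>"


section \<open>Quasiparabolic sets and subgroups\<close>

text \<open>The \<open>W\<close>-set is \<open>X\<close> with \<open>w\<close> acting as \<open>\<phi> w\<close>.\<close>

definition scaled_set ::
  "('a, 'b) monoid_scheme \<Rightarrow> 'a set \<Rightarrow> 'x set \<Rightarrow> ('a \<Rightarrow> 'x \<Rightarrow> 'x) \<Rightarrow> ('x \<Rightarrow> int) \<Rightarrow> bool"
where
  "scaled_set W S X \<phi> ht \<longleftrightarrow>
     group_action W X \<phi> \<and> (\<forall>s\<in>S. \<forall>x\<in>X. \<bar>ht (\<phi> s x) - ht x\<bar> \<le> 1)"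

definition quasiparabolic_set ::
  "('a, 'b) monoid_scheme \<Rightarrow> 'a set \<Rightarrow> 'x set \<Rightarrow> ('a \<Rightarrow> 'x \<Rightarrow> 'x) \<Rightarrow> ('x \<Rightarrow> int) \<Rightarrow> bool"
where
  "quasiparabolic_set W S X \<phi> ht \<longleftrightarrow>
     scaled_set W S X \<phi> ht \<and>
     (\<forall>r\<in>reflections W S. \<forall>x\<in>X. ht (\<phi> r x) = ht x \<longrightarrow> \<phi> r x = x) \<and>
     (\<forall>r\<in>reflections W S. \<forall>x\<in>X. \<forall>s\<in>S.
        ht (\<phi> r x) > ht x \<and> ht (\<phi> s (\<phi> r x)) < ht (\<phi> s x) \<longrightarrow> \<phi> r x = \<phi> s x)"

text \<open>
  Left translation on \<open>W/H\<close>; restricted because \<^const>\<open>group_action\<close> requires extensional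
  functions.
\<close>

definition lcoset_action ::
  "('a, 'b) monoid_scheme \<Rightarrow> 'a set \<Rightarrow> 'a \<Rightarrow> 'a set \<Rightarrow> 'a set"
where
  "lcoset_action W H w = (\<lambda>C\<in>lcosets\<^bsub>W\<^esub> H. w <#\<^bsub>W\<^esub> C)"

definition lcoset_height :: "('a, 'b) monoid_scheme \<Rightarrow> 'a set \<Rightarrow> 'a set \<Rightarrow> int" where
  "lcoset_height W S C = int (LEAST n. \<exists>v\<in>C. cox_length W S v = n)"

definition quasiparabolic_subgroup ::
  "('a, 'b) monoid_scheme \<Rightarrow> 'a set \<Rightarrow> 'a set \<Rightarrow> bool"
where
  "quasiparabolic_subgroup W S H \<longleftrightarrow>
     subgroup H W \<and>
     quasiparabolic_set W S (lcosets\<^bsub>W\<^esub> H) (lcoset_action W H) (lcoset_height W S)"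

end

theory Submission
  imports Defs
begin

text \<open>
  The strong exchange condition is extracted from the presentation: the parity of the number of
  times a word crosses the wall of a reflection \<open>r\<close> is invariant under the defining relations, and
  it is odd exactly when \<open>r\<close> shortens the element.

  Every coset \<open>gH\<close> with \<open>H \<subseteq> W\<^sub>I\<close> is \<open>waH\<close> for the minimal representative \<open>w\<close> of \<open>gW\<^sub>I\<close> and some
  \<open>a \<in> W\<^sub>I\<close>, and \<open>ht(waH) = \<ell>(w) + ht(aH)\<close>. If \<open>r\<close> fixes \<open>wW\<^sub>I\<close>, both axioms for \<open>r\<close> reduce to those
  of \<open>W\<^sub>I/H\<close> for the reflection \<open>w\<^sup>-\<^sup>1rw\<close>. Otherwise write \<open>rw = w'v\<close> with \<open>w'\<close> minimal and
  \<open>v \<in> W\<^sub>I\<close>, where up to exchanging \<open>w\<close> and \<open>w'\<close> we have \<open>\<ell>(rw) > \<ell>(w)\<close>. Strong exchange must delete a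
  letter of \<open>w'\<close>, so \<open>\<ell>(w') > \<ell>(w) + \<ell>(v)\<close>, and this outweighs the possible drop
  \<open>ht(aH) - ht(vaH) \<le> \<ell>(v)\<close>. Hence (QP1) is vacuous for such \<open>r\<close>, and in (QP2) the lengths are
  forced so tightly that \<open>v = 1\<close> and \<open>rw = sw\<close>.
\<close>

section \<open>Left coset actions\<close>

text \<open>The height of the coset \<open>gH\<close> as a function of its representative
  \<open>g\<close>, so that the argument computes with group elements instead of cosets.\<close>

definition coset_length :: "('a, 'b) monoid_scheme \<Rightarrow> 'a set \<Rightarrow> 'a set \<Rightarrow> 'a \<Rightarrow> nat" where
  "coset_length W S H g = (LEAST n. \<exists>h\<in>H. cox_length W S (g \<otimes>\<^bsub>W\<^esub> h) = n)"

lemma lcoset_height_l_coset: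
  "lcoset_height W S (g <#\<^bsub>W\<^esub> H) = int (coset_length W S H g)"
  by (simp add: lcoset_height_def coset_length_def l_coset_def)

context group
begin

lemma inv_mult_cancel:
  assumes "x \<in> carrier G" "y \<in> carrier G"
  shows "inv x \<otimes> (x \<otimes> y) = y" "x \<otimes> (inv x \<otimes> y) = y"
  using assms by (simp_all flip: m_assoc)

lemma eq_mult_inv:
  assumes "a \<otimes> b = c" "a \<in> carrier G" "b \<in> carrier G"
  shows "a = c \<otimes> inv b"
  using assms by (auto simp: m_assoc)

lemma l_coset_eqI:
  assumes "subgroup H G" "a \<in> carrier G" "b \<in> carrier G" "inv a \<otimes> b \<in> H"
  shows "a <# H = b <# H"
  using assms subgroup.lcos_module_rev[of H G a b] l_repr_independence[of b a H] is_group by blast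

lemma lcoset_action_l_coset:
  assumes "subgroup H G" "w \<in> carrier G" "g \<in> carrier G"
  shows "lcoset_action G H w (g <# H) = (w \<otimes> g) <# H"
proof -
  have "g <# H \<in> lcosets H" using assms by (auto simp: LCOSETS_def)
  then show ?thesis
    using assms by (simp add: lcoset_action_def lcos_m_assoc subgroup.subset)
qed

lemma group_action_lcosets:
  assumes H: "subgroup H G"
  shows "group_action G (lcosets H) (lcoset_action G H)"
proof -
  have closed: "lcoset_action G H g C \<in> lcosets H" if "g \<in> carrier G" "C \<in> lcosets H" for g C
  proof -
    from \<open>C \<in> lcosets H\<close> obtain a where "a \<in> carrier G" "C = a <# H"
      by (auto simp: LCOSETS_def)
    then show ?thesis using that H lcoset_action_l_coset by (auto simp: LCOSETS_def)
  qed
  have mult: "lcoset_action G H (g \<otimes> k) C = lcoset_action G H g (lcoset_action G H k C)"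
    if "g \<in> carrier G" "k \<in> carrier G" "C \<in> lcosets H" for g k C
  proof -
    from \<open>C \<in> lcosets H\<close> obtain a where "a \<in> carrier G" "C = a <# H"
      by (auto simp: LCOSETS_def)
    then show ?thesis using that H by (simp add: lcoset_action_l_coset m_assoc)
  qed
  have one: "lcoset_action G H \<one> C = C" if "C \<in> lcosets H" for C
  proof -
    from \<open>C \<in> lcosets H\<close> obtain a where "a \<in> carrier G" "C = a <# H"
      by (auto simp: LCOSETS_def)
    then show ?thesis using H by (simp add: lcoset_action_l_coset)
  qed
  have bij: "lcoset_action G H g \<in> Bij (lcosets H)" if g: "g \<in> carrier G" for g
  proof -
    have "bij_betw (lcoset_action G H g) (lcosets H) (lcosets H)"
    proof (rule bij_betw_byWitness[where f' = "lcoset_action G H (inv g)"])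
      show "\<forall>C\<in>lcosets H. lcoset_action G H (inv g) (lcoset_action G H g C) = C"
        using g mult[of "inv g" g] one by simp
      show "\<forall>C\<in>lcosets H. lcoset_action G H g (lcoset_action G H (inv g) C) = C"
        using g mult[of g "inv g"] one by simp
    qed (use g closed in auto)
    then show ?thesis by (simp add: Bij_def lcoset_action_def)
  qed
  have "lcoset_action G H \<in> hom G (BijGroup (lcosets H))"
  proof (rule homI)
    fix g k assume gk: "g \<in> carrier G" "k \<in> carrier G"
    show "lcoset_action G H (g \<otimes> k) =
        lcoset_action G H g \<otimes>\<^bsub>BijGroup (lcosets H)\<^esub> lcoset_action G H k"
    proof (rule extensionalityI[of _ "lcosets H"])
      show "lcoset_action G H (g \<otimes> k) \<in> extensional (lcosets H)"
        by (simp add: lcoset_action_def)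
    qed (use gk bij mult in \<open>auto simp: BijGroup_def compose_def\<close>)
  qed (simp add: BijGroup_def bij)
  then show ?thesis
    by (simp add: group_action_def group_hom_def group_hom_axioms_def group_BijGroup is_group)
qed

text \<open>Left translation is always an action, so only the height conditions remain, and these
  can be read off on representatives. Applied both to \<open>W\<close> and to the standard parabolic
  subgroup.\<close>

lemma quasiparabolic_subgroup_iff:
  assumes H: "subgroup H G" and T: "T \<subseteq> carrier G"
  shows "quasiparabolic_subgroup G T H \<longleftrightarrow>
    (\<forall>s\<in>T. \<forall>g\<in>carrier G.
       \<bar>int (coset_length G T H (s \<otimes> g)) - int (coset_length G T H g)\<bar> \<le> 1) \<and>
    (\<forall>r\<in>reflections G T. \<forall>g\<in>carrier G.
       coset_length G T H (r \<otimes> g) = coset_length G T H g \<longrightarrow> (r \<otimes> g) <# H = g <# H) \<and>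
    (\<forall>r\<in>reflections G T. \<forall>g\<in>carrier G. \<forall>s\<in>T.
       coset_length G T H (r \<otimes> g) > coset_length G T H g \<and>
       coset_length G T H (s \<otimes> (r \<otimes> g)) < coset_length G T H (s \<otimes> g) \<longrightarrow>
       (r \<otimes> g) <# H = (s \<otimes> g) <# H)"
proof -
  have R: "r \<in> carrier G" if "r \<in> reflections G T" for r
    using that T by (auto simp: reflections_def)
  have S: "s \<in> carrier G" if "s \<in> T" for s using that T by auto
  have ball: "(\<forall>C\<in>lcosets H. P C) \<longleftrightarrow> (\<forall>g\<in>carrier G. P (g <# H))" for P
    by (auto simp: LCOSETS_def)
  show ?thesis
    unfolding quasiparabolic_subgroup_def quasiparabolic_set_def scaled_set_def ball
    using H R S
    by (simp add: group_action_lcosets lcoset_action_l_coset lcoset_height_l_coset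
        cong: ball_cong)
qed

end

section \<open>Coxeter systems and strong exchange\<close>

lemma sum_lessThan_add:
  fixes f :: "nat \<Rightarrow> nat"
  shows "(\<Sum>i<m + n. f i) = (\<Sum>i<m. f i) + (\<Sum>i<n. f (m + i))"
  by (induction n) auto

text \<open>
  For \<open>ss = [s\<^sub>1, \<dots>, s\<^sub>k]\<close> this is the parity of the number of \<open>i\<close> with
  \<open>t = s\<^sub>1 \<dots> s\<^sub>i \<dots> s\<^sub>1\<close>: geometrically, whether the gallery of \<open>ss\<close> ends on the other side
  of the wall of \<open>t\<close>.
\<close>

primrec crosses :: "('a, 'b) monoid_scheme \<Rightarrow> 'a list \<Rightarrow> 'a \<Rightarrow> bool" where
  "crosses W [] t \<longleftrightarrow> False"
| "crosses W (s # ss) t \<longleftrightarrow> (t = s) \<noteq> crosses W ss (s \<otimes>\<^bsub>W\<^esub> t \<otimes>\<^bsub>W\<^esub> s)"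

locale coxeter = group W for W (structure) +
  fixes S
  assumes coxeter_system: "coxeter_system W S"
begin

section \<open>Words in the generators and their wall crossings\<close>

definition word_val :: "'a list \<Rightarrow> 'a" where
  "word_val ss = foldr (\<otimes>) ss \<one>"

lemma word_val_simps [simp]: "word_val [] = \<one>" "word_val (s # ss) = s \<otimes> word_val ss"
  by (simp_all add: word_val_def)

abbreviation len :: "'a \<Rightarrow> nat" where
  "len \<equiv> cox_length W S"

lemma presentation:
  obtains m where "coxeter_matrix_on S m" "presented_by W S (coxeter_relators S m)"
  using coxeter_system by (auto simp: coxeter_system_def)

lemma gens_carrier: "S \<subseteq> carrier W"
  using presentation by (auto simp: presented_by_def)

lemma gen_carrier [simp]: "s \<in> S \<Longrightarrow> s \<in> carrier W"
  using gens_carrier by auto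

lemma word_val_closed [simp]: "ss \<in> lists S \<Longrightarrow> word_val ss \<in> carrier W"
  by (induction ss) auto

lemma word_val_append:
  "us \<in> lists S \<Longrightarrow> vs \<in> lists S \<Longrightarrow> word_val (us @ vs) = word_val us \<otimes> word_val vs"
proof (induction us)
  case (Cons a us)
  then show ?case using word_val_closed[of vs] word_val_closed[of us] by (simp add: m_assoc)
qed simp

lemma gen_square: assumes "s \<in> S" shows "s \<otimes> s = \<one>"
proof -
  obtain m where m: "coxeter_matrix_on S m" "presented_by W S (coxeter_relators S m)"
    by (rule presentation)
  \<comment> \<open>The diagonal entry of the Coxeter matrix is 1, so this relator is the two-letter
    word \<open>s s\<close>.\<close>
  have "concat (replicate (m s s) [(s, True), (s, True)]) \<in> coxeter_relators S m"
    using assms by (auto simp: coxeter_relators_def)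
  then have "[(s, True), (s, True)] \<in> coxeter_relators S m"
    using assms m(1) by (simp add: coxeter_matrix_on_def)
  from pres_eq.relator[of "[]" S "[]", OF _ _ this]
  have "pres_eq S (coxeter_relators S m) [(s, True), (s, True)] []" by simp
  then have "signed_word_val W [(s, True), (s, True)] = signed_word_val W []"
    using assms m(2) by (simp add: presented_by_def)
  then show ?thesis using assms by (simp add: signed_word_val_def)
qed

lemma gen_cancel: "s \<in> S \<Longrightarrow> x \<in> carrier W \<Longrightarrow> s \<otimes> (s \<otimes> x) = x"
  by (simp add: gen_square flip: m_assoc)

lemma gen_inv: "s \<in> S \<Longrightarrow> inv s = s"
  by (simp add: gen_square inv_equality)

lemma signed_word_val_eq: "u \<in> signed_words S \<Longrightarrow> signed_word_val W u = word_val (map fst u)"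
  by (induction u) (auto simp: signed_word_val_def gen_inv)

text \<open>The gallery of \<open>vs\<close> starts at the chamber \<open>word_val us\<close>;
  moving that chamber back to the identity conjugates the wall.\<close>

lemma crosses_append:
  assumes "us \<in> lists S" "t \<in> carrier W"
  shows "crosses W (us @ vs) t \<longleftrightarrow>
    crosses W us t \<noteq> crosses W vs (inv (word_val us) \<otimes> t \<otimes> word_val us)"
  using assms
proof (induction us arbitrary: t)
  case (Cons a us)
  then have "a \<in> S" "word_val us \<in> carrier W" "a \<otimes> t \<otimes> a \<in> carrier W" by auto
  then show ?case using Cons
    by (auto simp: m_assoc inv_mult_group gen_inv)
qed simp

lemma crosses_cancel:
  "s \<in> S \<Longrightarrow> t \<in> carrier W \<Longrightarrow> \<not> crosses W [s, s] t"
  by (auto simp: m_assoc gen_square)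
     (metis gen_cancel gen_carrier gen_square m_assoc m_closed r_one)

text \<open>The reflection belonging to position \<open>i\<close> (counted from 0) of the word
  \<open>s t s t ...\<close> is \<open>(s t)^i s\<close>; the sum counts the positions at which it
  equals \<open>x\<close>.\<close>

lemma crosses_alternating:
  assumes "s \<in> S" "t \<in> S" "x \<in> carrier W"
  shows "crosses W (concat (replicate k [s, t])) x \<longleftrightarrow>
    odd (\<Sum>i<k + k. of_bool (x = (s \<otimes> t) [^] i \<otimes> s) :: nat)"
  using assms(3)
proof (induction k arbitrary: x)
  case (Suc k)
  let ?p = "\<lambda>x i. x = (s \<otimes> t) [^] (i::nat) \<otimes> s"
  \<comment> \<open>Removing the leading pair \<open>s, t\<close> conjugates \<open>x\<close>, which
    lowers every index by two; \<open>p0\<close> and \<open>p1\<close> treat the two removed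
    positions.\<close>
  have shift: "?p (t \<otimes> (s \<otimes> x \<otimes> s) \<otimes> t) i = ?p x (Suc (Suc i))" for i
  proof -
    let ?c = "(s \<otimes> t) [^] i"
    have c: "?c \<in> carrier W" using assms by simp
    have "(s \<otimes> t) [^] Suc (Suc i) \<otimes> s = s \<otimes> t \<otimes> (?c \<otimes> s) \<otimes> (t \<otimes> s)"
      using assms c nat_pow_Suc2[of "s \<otimes> t" "Suc i"] by (simp add: m_assoc)
    also have "x = \<dots> \<longleftrightarrow> t \<otimes> (s \<otimes> x \<otimes> s) \<otimes> t = ?c \<otimes> s"
    proof
      assume "x = s \<otimes> t \<otimes> (?c \<otimes> s) \<otimes> (t \<otimes> s)"
      then show "t \<otimes> (s \<otimes> x \<otimes> s) \<otimes> t = ?c \<otimes> s"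
        using assms c by (simp add: m_assoc gen_cancel gen_square)
    next
      assume "t \<otimes> (s \<otimes> x \<otimes> s) \<otimes> t = ?c \<otimes> s"
      then have "s \<otimes> t \<otimes> (?c \<otimes> s) \<otimes> (t \<otimes> s) = s \<otimes> t \<otimes> (t \<otimes> (s \<otimes> x \<otimes> s) \<otimes> t) \<otimes> (t \<otimes> s)"
        by simp
      also have "\<dots> = x" using assms Suc.prems by (simp add: m_assoc gen_cancel gen_square)
      finally show "x = s \<otimes> t \<otimes> (?c \<otimes> s) \<otimes> (t \<otimes> s)" by simp
    qed
    finally show ?thesis by auto
  qed
  have p1: "s \<otimes> x \<otimes> s = t \<longleftrightarrow> ?p x 1"
  proof -
    have "s \<otimes> x \<otimes> s = t \<longleftrightarrow> x = s \<otimes> t \<otimes> s"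
      using assms Suc.prems
      by (metis gen_cancel gen_carrier gen_square m_assoc m_closed r_one)
    then show ?thesis using assms by simp
  qed
  have split: "(\<Sum>i<Suc k + Suc k. of_bool (?p x i) :: nat) =
      of_bool (?p x 0) + (of_bool (?p x 1) + (\<Sum>i<k + k. of_bool (?p x (Suc (Suc i)))))"
    by (simp only: add_Suc add_Suc_right sum.lessThan_Suc_shift One_nat_def)
  have IH: "crosses W (concat (replicate k [s, t])) (t \<otimes> (s \<otimes> x \<otimes> s) \<otimes> t) \<longleftrightarrow>
     odd (\<Sum>i<k + k. of_bool (?p x (Suc (Suc i))) :: nat)"
    using Suc.IH[of "t \<otimes> (s \<otimes> x \<otimes> s) \<otimes> t"] Suc.prems assms unfolding shift by simp
  have p0: "x = s \<longleftrightarrow> ?p x 0" using assms by simp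
  have "crosses W (concat (replicate (Suc k) [s, t])) x \<longleftrightarrow>
     (x = s) \<noteq> ((s \<otimes> x \<otimes> s = t) \<noteq>
        crosses W (concat (replicate k [s, t])) (t \<otimes> (s \<otimes> x \<otimes> s) \<otimes> t))"
    by simp
  then show ?case unfolding split IH p0 p1 by auto
qed simp

text \<open>If \<open>(s t)^k = 1\<close>, the reflections at positions \<open>i\<close> and
  \<open>k + i\<close> coincide, so each wall is met an even number of times.\<close>

lemma not_crosses_relator:
  assumes "s \<in> S" "t \<in> S" "x \<in> carrier W" "(s \<otimes> t) [^] k = \<one>"
  shows "\<not> crosses W (concat (replicate k [s, t])) x"
proof -
  have "(s \<otimes> t) [^] (k + i) = (s \<otimes> t) [^] i" for i
    using assms by (simp flip: nat_pow_mult)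
  then have "(\<Sum>i<k + k. of_bool (x = (s \<otimes> t) [^] i \<otimes> s) :: nat) =
      2 * (\<Sum>i<k. of_bool (x = (s \<otimes> t) [^] i \<otimes> s))"
    unfolding sum_lessThan_add by simp
  then show ?thesis using crosses_alternating assms by simp
qed

lemma word_val_alternating:
  "s \<in> S \<Longrightarrow> t \<in> S \<Longrightarrow> word_val (concat (replicate k [s, t])) = (s \<otimes> t) [^] k"
proof (induction k)
  case (Suc k)
  then have "word_val (concat (replicate (Suc k) [s, t])) = (s \<otimes> t) \<otimes> (s \<otimes> t) [^] k"
    by (simp add: m_assoc)
  then show ?case using nat_pow_Suc2[of "s \<otimes> t" k] Suc.prems by simp
qed simp

text \<open>The words \<open>s s\<close> and the relators have even length, value one and no net
  crossing. By \<open>crosses_append\<close>, deleting such a subword preserves both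
  parities.\<close>

lemma pres_eq_invariant:
  assumes m: "presented_by W S (coxeter_relators S m)"
  shows "pres_eq S (coxeter_relators S m) u v \<Longrightarrow>
    u \<in> signed_words S \<and> v \<in> signed_words S \<and>
    even (length u) = even (length v) \<and>
    (\<forall>x\<in>carrier W. crosses W (map fst u) x = crosses W (map fst v) x)"
proof (induction rule: pres_eq.induct)
  case (cancel u v s b)
  then have uv: "map fst u \<in> lists S" "map fst v \<in> lists S"
    by (auto simp: in_lists_conv_set)
  have "crosses W (map fst u @ [s, s] @ map fst v) x = crosses W (map fst u @ map fst v) x"
    if x: "x \<in> carrier W" for x
  proof -
    let ?y = "inv (word_val (map fst u)) \<otimes> x \<otimes> word_val (map fst u)"
    have y: "?y \<in> carrier W" using uv x by simp
    have "crosses W ([s, s] @ map fst v) ?y = crosses W (map fst v) ?y"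
      using crosses_append[of "[s, s]" ?y] crosses_cancel[of s ?y] cancel y
      by (simp add: gen_square)
    then show ?thesis using uv x by (simp only: crosses_append)
  qed
  then show ?case using cancel by (auto simp: m_assoc)
next
  case (relator u v r)
  then obtain s t where st: "s \<in> S" "t \<in> S"
    and r: "r = concat (replicate (m s t) [(s, True), (t, True)])"
    by (auto simp: coxeter_relators_def)
  let ?k = "m s t"
  have fr: "map fst r = concat (replicate ?k [s, t])"
    unfolding r by (simp add: map_concat)
  have rS: "r \<in> signed_words S" using st unfolding r by (auto simp: in_lists_conv_set)
  \<comment> \<open>The relator represents the identity of \<open>W\<close>. This supplies the
    premise of \<open>not_crosses_relator\<close> and also means that the wall seen by
    \<open>v\<close> is not moved.\<close>
  have "pres_eq S (coxeter_relators S m) r []"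
    using pres_eq.relator[of "[]" S "[]" r] relator by simp
  then have "signed_word_val W r = signed_word_val W []"
    using m rS by (simp add: presented_by_def)
  then have "word_val (map fst r) = \<one>"
    using signed_word_val_eq[OF rS] by (simp add: signed_word_val_def)
  then have one: "(s \<otimes> t) [^] ?k = \<one>" using st by (simp add: fr word_val_alternating)
  have uv: "map fst u \<in> lists S" "map fst v \<in> lists S" "map fst r \<in> lists S"
    using relator rS by (auto simp: in_lists_conv_set)
  have "crosses W (map fst u @ map fst r @ map fst v) x = crosses W (map fst u @ map fst v) x"
    if x: "x \<in> carrier W" for x
  proof -
    let ?y = "inv (word_val (map fst u)) \<otimes> x \<otimes> word_val (map fst u)"
    have y: "?y \<in> carrier W" using uv x by simp
    have "crosses W (map fst r @ map fst v) ?y = crosses W (map fst v) ?y"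
      using crosses_append[of "map fst r" ?y] not_crosses_relator[OF st y one] y uv
        \<open>word_val (map fst r) = \<one>\<close> by (simp add: fr)
    then show ?thesis using uv x by (simp only: crosses_append)
  qed
  moreover have "even (length r)" unfolding r by (simp add: length_concat sum_list_replicate)
  ultimately show ?case using relator rS by simp
qed auto

text \<open>Words with the same value are related by the presentation, so the parities of length and
  of crossings depend on the group element alone.\<close>

lemma word_val_eqD:
  assumes "us \<in> lists S" "vs \<in> lists S" "word_val us = word_val vs"
  shows "even (length us) = even (length vs)"
    and "x \<in> carrier W \<Longrightarrow> crosses W us x = crosses W vs x"
proof -
  obtain m where m: "presented_by W S (coxeter_relators S m)"
    by (rule presentation)
  let ?f = "map (\<lambda>s. (s, True))"
  have f: "map fst (?f ws) = ws" for ws :: "'a list" by (induction ws) auto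
  have S: "?f us \<in> signed_words S" "?f vs \<in> signed_words S" using assms by (auto simp: in_lists_conv_set)
  then have "pres_eq S (coxeter_relators S m) (?f us) (?f vs)"
    using m assms f unfolding presented_by_def by (metis signed_word_val_eq)
  from pres_eq_invariant[OF m this, unfolded f] show "even (length us) = even (length vs)"
    and "x \<in> carrier W \<Longrightarrow> crosses W us x = crosses W vs x"
    by simp_all
qed

lemma rev_lists [simp]: "rev ss \<in> lists S \<longleftrightarrow> ss \<in> lists S"
  by (simp add: in_lists_conv_set)

lemma inv_word_val: "ss \<in> lists S \<Longrightarrow> inv (word_val ss) = word_val (rev ss)"
proof (induction ss)
  case (Cons a ss)
  then show ?case using word_val_closed[of ss]
    by (simp add: word_val_append inv_mult_group gen_inv)
qed simp

lemma mem_generate_iff: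
  assumes "J \<subseteq> S"
  shows "w \<in> generate W J \<longleftrightarrow> (\<exists>ss\<in>lists J. word_val ss = w)"
proof
  have J: "lists J \<subseteq> lists S" using assms by (rule lists_mono)
  assume "w \<in> generate W J"
  then show "\<exists>ss\<in>lists J. word_val ss = w"
  proof induction
    case one
    show ?case by (rule bexI[of _ "[]"]) auto
  next
    case (incl h)
    then show ?case using assms by (intro bexI[of _ "[h]"]) auto
  next
    case (inv h)
    then show ?case using assms by (intro bexI[of _ "[h]"]) (auto simp: gen_inv)
  next
    case (eng h1 h2)
    then obtain us vs where "us \<in> lists J" "word_val us = h1" "vs \<in> lists J" "word_val vs = h2"
      by auto
    moreover from this have "us \<in> lists S" "vs \<in> lists S" using J by blast+
    ultimately show ?case by (intro bexI[of _ "us @ vs"]) (auto simp: word_val_append)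
  qed
next
  assume "\<exists>ss\<in>lists J. word_val ss = w"
  then obtain ss where "ss \<in> lists J" "word_val ss = w" by auto
  then show "w \<in> generate W J"
    by (induction ss arbitrary: w) (auto intro: generate.intros)
qed

lemma generate_gens: "generate W S = carrier W"
  using presentation by (auto simp: presented_by_def)

section \<open>The length function and its parity\<close>

lemma reduced_word:
  assumes "w \<in> carrier W"
  obtains ss where "ss \<in> lists S" "word_val ss = w" "length ss = len w"
proof -
  have "\<exists>n. \<exists>ss\<in>lists S. length ss = n \<and> foldr (\<otimes>) ss \<one> = w"
    using assms mem_generate_iff[of S w] by (auto simp: generate_gens word_val_def)
  from LeastI_ex[OF this] show ?thesis
    using that unfolding cox_length_def word_val_def by auto
qed

lemma len_word_val_le: "ss \<in> lists S \<Longrightarrow> len (word_val ss) \<le> length ss"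
  unfolding cox_length_def word_val_def by (rule Least_le) auto

lemma even_len_word_val: "ss \<in> lists S \<Longrightarrow> even (len (word_val ss)) = even (length ss)"
  by (metis reduced_word word_val_closed word_val_eqD(1))

lemma even_len_mult:
  assumes "a \<in> carrier W" "b \<in> carrier W"
  shows "even (len (a \<otimes> b)) \<longleftrightarrow> even (len a + len b)"
proof -
  obtain us vs where "us \<in> lists S" "word_val us = a" "length us = len a"
    "vs \<in> lists S" "word_val vs = b" "length vs = len b"
    using assms by (metis reduced_word)
  then show ?thesis using even_len_word_val[of "us @ vs"] by (simp add: word_val_append)
qed

lemma len_mult_le:
  assumes "a \<in> carrier W" "b \<in> carrier W"
  shows "len (a \<otimes> b) \<le> len a + len b"
proof -
  obtain us vs where "us \<in> lists S" "word_val us = a" "length us = len a"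
    "vs \<in> lists S" "word_val vs = b" "length vs = len b"
    using assms by (metis reduced_word)
  then show ?thesis using len_word_val_le[of "us @ vs"] by (simp add: word_val_append)
qed

lemma len_inv_le: assumes "a \<in> carrier W" shows "len (inv a) \<le> len a"
proof -
  obtain us where "us \<in> lists S" "word_val us = a" "length us = len a"
    using assms by (metis reduced_word)
  then show ?thesis using len_word_val_le[of "rev us"] inv_word_val[of us] by simp
qed

lemma len_inv [simp]: "a \<in> carrier W \<Longrightarrow> len (inv a) = len a"
  using len_inv_le[of a] len_inv_le[of "inv a"] by simp

lemma len_one [simp]: "len \<one> = 0"
  using len_word_val_le[of "[]"] by simp

lemma len_eq_0_iff: "a \<in> carrier W \<Longrightarrow> len a = 0 \<longleftrightarrow> a = \<one>"
  by (metis reduced_word len_one length_0_conv word_val_simps(1))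

lemma len_gen: assumes "s \<in> S" shows "len s = 1"
proof -
  have "len s \<le> 1" "odd (len s)"
    using len_word_val_le[of "[s]"] even_len_word_val[of "[s]"] assms by auto
  then show ?thesis by (cases "len s = 0") auto
qed

lemma len_triangle_left:
  assumes "a \<in> carrier W" "b \<in> carrier W"
  shows "len b \<le> len a + len (a \<otimes> b)"
  using len_mult_le[of "inv a" "a \<otimes> b"] assms by (simp add: inv_mult_cancel)

lemma len_gen_mult:
  assumes "s \<in> S" "a \<in> carrier W"
  shows "len (s \<otimes> a) \<le> len a + 1" "len a \<le> len (s \<otimes> a) + 1"
  using len_mult_le[of s a] len_triangle_left[of s a] assms by (auto simp: len_gen)

section \<open>Reflections and the strong exchange condition\<close>

lemma reflectionE:
  assumes "r \<in> reflections W S"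
  obtains w s where "w \<in> carrier W" "s \<in> S" "r = w \<otimes> s \<otimes> inv w"
  using assms by (auto simp: reflections_def)

lemma reflection_closed [simp]: "r \<in> reflections W S \<Longrightarrow> r \<in> carrier W"
  by (auto elim!: reflectionE)

lemma reflection_square: "r \<in> reflections W S \<Longrightarrow> r \<otimes> r = \<one>"
  by (elim reflectionE) (simp add: m_assoc inv_mult_cancel gen_cancel)

lemma reflection_cancel: "r \<in> reflections W S \<Longrightarrow> x \<in> carrier W \<Longrightarrow> r \<otimes> (r \<otimes> x) = x"
  by (simp add: reflection_square flip: m_assoc)

lemma reflection_inv: "r \<in> reflections W S \<Longrightarrow> inv r = r"
  by (simp add: reflection_square inv_equality)

lemma reflection_conj:
  assumes "r \<in> reflections W S" "g \<in> carrier W"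
  shows "g \<otimes> r \<otimes> inv g \<in> reflections W S"
proof -
  obtain w s where "w \<in> carrier W" "s \<in> S" "r = w \<otimes> s \<otimes> inv w"
    using assms by (elim reflectionE)
  then have "g \<otimes> r \<otimes> inv g = (g \<otimes> w) \<otimes> s \<otimes> inv (g \<otimes> w)" "g \<otimes> w \<in> carrier W"
    using assms by (simp_all add: m_assoc inv_mult_group)
  then show ?thesis using \<open>s \<in> S\<close> unfolding reflections_def by blast
qed

lemma odd_len_reflection: "r \<in> reflections W S \<Longrightarrow> odd (len r)"
  by (elim reflectionE) (simp add: even_len_mult len_gen)

lemma len_reflection_mult_neq:
  assumes "r \<in> reflections W S" "a \<in> carrier W"
  shows "len (r \<otimes> a) \<noteq> len a"
proof
  assume "len (r \<otimes> a) = len a"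
  then show False using even_len_mult[of r a] odd_len_reflection[of r] assms by simp
qed

text \<open>An odd count is nonzero, so \<open>t = s_1 ... s_i ... s_1\<close> for some position
  \<open>i\<close>, and multiplying by \<open>t\<close> erases that letter. The induction conjugates
  \<open>t\<close> past the leading letters until it equals the current one.\<close>

lemma crosses_imp_deletion:
  assumes "ss \<in> lists S" "t \<in> carrier W" "crosses W ss t"
  shows "\<exists>xs s ys. ss = xs @ s # ys \<and> t \<otimes> word_val ss = word_val (xs @ ys)"
  using assms
proof (induction ss arbitrary: t)
  case (Cons a ss)
  then have a: "a \<in> S" "ss \<in> lists S" by auto
  show ?case
  proof (cases "t = a")
    case True
    then have "a # ss = [] @ a # ss \<and> t \<otimes> word_val (a # ss) = word_val ([] @ ss)"
      using a by (simp add: gen_cancel)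
    then show ?thesis by blast
  next
    case False
    then have "crosses W ss (a \<otimes> t \<otimes> a)" using Cons.prems by simp
    then obtain xs s ys where *: "ss = xs @ s # ys"
      "(a \<otimes> t \<otimes> a) \<otimes> word_val ss = word_val (xs @ ys)"
      using Cons.IH a Cons.prems by (metis gen_carrier m_closed)
    have t: "t \<in> carrier W" using Cons.prems by simp
    have "t \<otimes> word_val (a # ss) = a \<otimes> ((a \<otimes> t \<otimes> a) \<otimes> word_val ss)"
      using a(1) t word_val_closed[OF a(2)] by (simp add: m_assoc gen_cancel)
    also have "\<dots> = word_val ((a # xs) @ ys)" using * by simp
    finally have "a # ss = (a # xs) @ s # ys \<and> t \<otimes> word_val (a # ss) = word_val ((a # xs) @ ys)"
      using * by simp
    then show ?thesis by blast
  qed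
qed simp

text \<open>Crossings depend only on the value, so \<open>ss\<close> may be replaced by a reduced
  word, where a deletion really lowers the length.\<close>

lemma crosses_imp_shorter:
  assumes "ss \<in> lists S" "t \<in> carrier W" "crosses W ss t"
  shows "len (t \<otimes> word_val ss) < len (word_val ss)"
proof -
  obtain us where us: "us \<in> lists S" "word_val us = word_val ss" "length us = len (word_val ss)"
    using assms by (metis reduced_word word_val_closed)
  then have "crosses W us t" using assms word_val_eqD(2) by blast
  then obtain xs s ys where "us = xs @ s # ys" "t \<otimes> word_val us = word_val (xs @ ys)"
    using crosses_imp_deletion us assms by metis
  then show ?thesis using us len_word_val_le[of "xs @ ys"] by auto
qed

text \<open>Take the palindrome \<open>us @ [s] @ rev us\<close>, where \<open>us\<close> spells
  \<open>w\<close> and \<open>r = w s (inv w)\<close>. Its outer halves together spell the identity,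
  so their crossings cancel, and the middle letter contributes the odd one.\<close>

lemma crosses_reflection:
  assumes r: "r \<in> reflections W S" and ss: "ss \<in> lists S" "word_val ss = r"
  shows "crosses W ss r"
proof -
  obtain w s where w: "w \<in> carrier W" "s \<in> S" "r = w \<otimes> s \<otimes> inv w"
    using r by (elim reflectionE)
  obtain us where us: "us \<in> lists S" "word_val us = w" using w by (metis reduced_word)
  have val: "word_val (us @ [s] @ rev us) = r"
    using us w inv_word_val[of us] by (simp add: word_val_append m_assoc)
  have conj: "inv w \<otimes> r \<otimes> w = s" using w by (simp add: m_assoc inv_mult_cancel)
  have "word_val (us @ rev us) = \<one>"
    using us w(1) inv_word_val[of us] by (simp add: word_val_append flip: inv_word_val)
  then have "crosses W (us @ rev us) r = crosses W [] r"
    using word_val_eqD(2)[of "us @ rev us" "[]" r] us(1) r by simp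
  then have "crosses W us r = crosses W (rev us) s"
    using crosses_append[of us r] us r conj by simp
  then have "crosses W (us @ [s] @ rev us) r"
    using crosses_append[of us r "[s] @ rev us"] us r w conj by (simp add: gen_square)
  then show ?thesis using word_val_eqD(2)[of "us @ [s] @ rev us" ss r] us w r ss val by simp
qed

text \<open>For the converse, a word \<open>us\<close> for \<open>r\<close> crosses the wall of
  \<open>r\<close>. If \<open>ss\<close> did not, then \<open>us @ ss\<close> would, and
  \<open>r\<close> would shorten \<open>r (word_val ss)\<close>, against the assumption.\<close>

lemma crosses_iff_shorter:
  assumes ss: "ss \<in> lists S" and r: "r \<in> reflections W S"
  shows "crosses W ss r \<longleftrightarrow> len (r \<otimes> word_val ss) < len (word_val ss)"
proof
  assume "crosses W ss r"
  then show "len (r \<otimes> word_val ss) < len (word_val ss)"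
    using assms crosses_imp_shorter by simp
next
  assume less: "len (r \<otimes> word_val ss) < len (word_val ss)"
  obtain us where us: "us \<in> lists S" "word_val us = r" using r reflection_closed by (metis reduced_word)
  show "crosses W ss r"
  proof (rule ccontr)
    assume "\<not> crosses W ss r"
    then have "crosses W (us @ ss) r"
      using crosses_append[of us r ss] crosses_reflection[OF r us] us r
      by (simp add: reflection_inv reflection_square)
    then have "len (r \<otimes> word_val (us @ ss)) < len (word_val (us @ ss))"
      using us r ss by (intro crosses_imp_shorter) auto
    then show False using less us r ss by (simp add: word_val_append reflection_cancel)
  qed
qed

lemma strong_exchange:
  assumes "ss \<in> lists S" "r \<in> reflections W S" "len (r \<otimes> word_val ss) < len (word_val ss)"
  obtains xs s ys where "ss = xs @ s # ys" "r \<otimes> word_val ss = word_val (xs @ ys)"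
  using assms crosses_iff_shorter crosses_imp_deletion reflection_closed by metis

lemma gen_reflection: assumes "s \<in> S" shows "s \<in> reflections W S"
proof -
  have "s = \<one> \<otimes> s \<otimes> inv \<one>" using assms by simp
  then show ?thesis using assms unfolding reflections_def by blast
qed

text \<open>This makes length in \<open>W\<^sub>I\<close> agree with length in \<open>W\<close>.
  Reduce the tail first. If the head then shortens it, strong exchange gives a shorter word in the
  same letters and induction applies; otherwise parity forces the length up by exactly one.\<close>

lemma reduced_subword:
  assumes "ss \<in> lists S"
  shows "\<exists>us. set us \<subseteq> set ss \<and> word_val us = word_val ss \<and> length us = len (word_val ss)"
  using assms
proof (induction "length ss" arbitrary: ss rule: less_induct)
  case less
  show ?case
  proof (cases ss)
    case Nil
    then show ?thesis by (intro exI[of _ "[]"]) simp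
  next
    case (Cons a vs)
    then have a: "a \<in> S" "vs \<in> lists S" using less.prems by auto
    obtain us where us: "set us \<subseteq> set vs" "word_val us = word_val vs" "length us = len (word_val vs)"
      using less.hyps[of vs] Cons a by auto
    then have usS: "us \<in> lists S" using a by auto
    show ?thesis
    proof (cases "len (a \<otimes> word_val us) < len (word_val us)")
      case True
      obtain xs s ys where ex: "us = xs @ s # ys" "a \<otimes> word_val us = word_val (xs @ ys)"
        using strong_exchange[OF usS gen_reflection True] a by metis
      have "length us \<le> length vs" using us len_word_val_le a by simp
      then have "length (xs @ ys) < length ss" "xs @ ys \<in> lists S"
        using ex usS Cons by auto
      then obtain zs where "set zs \<subseteq> set (xs @ ys)" "word_val zs = word_val (xs @ ys)"
          "length zs = len (word_val (xs @ ys))"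
        using less.hyps by blast
      then show ?thesis using ex us Cons by (intro exI[of _ zs]) auto
    next
      case False
      then have "len (a \<otimes> word_val us) = len (word_val us) + 1"
        using len_gen_mult[of a "word_val us"] len_reflection_mult_neq[OF gen_reflection, of a "word_val us"]
          a usS by simp
      then show ?thesis using us Cons by (intro exI[of _ "a # us"]) auto
    qed
  qed
qed

end

section \<open>Minimal coset representatives\<close>

locale parabolic = coxeter +
  fixes I
  assumes subset_gens: "I \<subseteq> S"
begin

section \<open>Words, lengths and reflections inside the parabolic subgroup\<close>

abbreviation P where "P \<equiv> generate W I"

lemma I_lists: "ss \<in> lists I \<Longrightarrow> ss \<in> lists S"
  using subset_gens by (auto simp: in_lists_conv_set)

lemma subgroup_P: "subgroup P W"
  using subset_gens gens_carrier by (intro generate_is_subgroup) blast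

lemma P_carrier [simp]: "v \<in> P \<Longrightarrow> v \<in> carrier W"
  using subgroup_P by (rule subgroup.mem_carrier)

lemma P_mult [simp]: "u \<in> P \<Longrightarrow> v \<in> P \<Longrightarrow> u \<otimes> v \<in> P"
  by (rule generate.eng)

lemma P_inv [simp]: "v \<in> P \<Longrightarrow> inv v \<in> P"
  using subgroup_P by (rule subgroup.m_inv_closed)

lemma gen_in_P [simp]: "s \<in> I \<Longrightarrow> s \<in> P"
  by (rule generate.incl)

lemma word_val_in_P: "ss \<in> lists I \<Longrightarrow> word_val ss \<in> P"
  using mem_generate_iff[OF subset_gens] by auto

lemma reduced_word_P:
  assumes "v \<in> P"
  obtains ss where "ss \<in> lists I" "word_val ss = v" "length ss = len v"
proof -
  obtain ss where "ss \<in> lists I" "word_val ss = v"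
    using assms mem_generate_iff[OF subset_gens] by auto
  then show ?thesis using reduced_subword[of ss] I_lists[of ss] that
    by (fastforce simp: in_lists_conv_set)
qed

lemma cox_length_parabolic: "v \<in> P \<Longrightarrow> cox_length (std_parabolic W I) I v = len v"
proof -
  assume v: "v \<in> P"
  then obtain ss where ss: "ss \<in> lists I" "word_val ss = v" "length ss = len v"
    by (rule reduced_word_P)
  have "(LEAST n. \<exists>ss\<in>lists I. length ss = n \<and> word_val ss = v) = len v"
    by (rule Least_equality) (use ss in blast, metis I_lists len_word_val_le)
  then show ?thesis by (subst cox_length_def) (simp add: std_parabolic_def word_val_def)
qed

text \<open>Strong exchange is applied to \<open>r\<close> itself: \<open>r r = 1\<close> is
  shorter, so a reduced word \<open>xs @ s # ys\<close> of \<open>r\<close> over \<open>I\<close>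
  has \<open>xs ys = 1\<close>, which exhibits \<open>r\<close> as a conjugate of \<open>s\<close>
  by an element of \<open>P\<close>.\<close>

lemma reflection_parabolic:
  assumes r: "r \<in> reflections W S" "r \<in> P"
  shows "r \<in> reflections (std_parabolic W I) I"
proof -
  obtain ss where ss: "ss \<in> lists I" "word_val ss = r" "length ss = len r"
    using r by (elim reduced_word_P)
  have "len (r \<otimes> word_val ss) < len (word_val ss)"
    using odd_len_reflection[OF r(1)] r ss by (simp add: reflection_square odd_pos)
  then obtain xs s ys where ex: "ss = xs @ s # ys" "r \<otimes> word_val ss = word_val (xs @ ys)"
    using strong_exchange I_lists ss r by metis
  have I: "xs \<in> lists I" "ys \<in> lists I" "s \<in> I" using ex ss by auto
  have S: "xs \<in> lists S" "ys \<in> lists S" "s \<in> S" using I I_lists subset_gens by auto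
  have "word_val xs \<otimes> word_val ys = \<one>"
    using ex ss r S by (simp add: word_val_append reflection_square)
  then have "word_val ys = inv (word_val xs)"
    using S inv_equality[of "word_val ys" "word_val xs"]
    by (metis inv_comm inv_equality word_val_closed)
  then have "r = word_val xs \<otimes> s \<otimes> inv (word_val xs)"
    using ex ss S by (auto simp: word_val_append m_assoc)
  then have "r = word_val xs \<otimes>\<^bsub>std_parabolic W I\<^esub> s \<otimes>\<^bsub>std_parabolic W I\<^esub>
      inv\<^bsub>std_parabolic W I\<^esub> (word_val xs)"
    using subgroup_P word_val_in_P[OF I(1)] by (simp add: std_parabolic_def)
  moreover have "word_val xs \<in> carrier (std_parabolic W I)"
    using word_val_in_P[OF I(1)] by (simp add: std_parabolic_def)
  ultimately show ?thesis using I(3) unfolding reflections_def by blast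
qed

text \<open>Minimality in \<open>w P\<close> is encoded as additivity of length, the form in which
  it is used; \<open>shortest_imp_min_rep\<close> derives it from being shortest.\<close>

definition min_rep :: "'a \<Rightarrow> bool" where
  "min_rep w \<longleftrightarrow> w \<in> carrier W \<and> (\<forall>v\<in>P. len (w \<otimes> v) = len w + len v)"

lemma min_repD:
  assumes "min_rep w"
  shows "w \<in> carrier W" "v \<in> P \<Longrightarrow> len (w \<otimes> v) = len w + len v"
  using assms by (auto simp: min_rep_def)

text \<open>A reduced word over \<open>I\<close> is appended to \<open>w\<close> letter by letter.
  If a letter lowered the length, strong exchange would delete a letter either of \<open>w\<close>
  or of the appended word, and both are impossible.\<close>

lemma shortest_imp_min_rep:
  assumes w: "w \<in> carrier W" and shortest: "\<And>v. v \<in> P \<Longrightarrow> len w \<le> len (w \<otimes> v)"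
  shows "min_rep w"
proof -
  obtain us where us: "us \<in> lists S" "word_val us = w" "length us = len w"
    using w by (rule reduced_word)
  have add: "len (w \<otimes> word_val ss) = len w + length ss"
    if "ss \<in> lists I" "length ss = len (word_val ss)" for ss
    using that
  proof (induction ss rule: rev_induct)
    case (snoc s ss)
    then have I: "s \<in> I" "ss \<in> lists I" by auto
    then have S: "s \<in> S" "ss \<in> lists S" using subset_gens I_lists by auto
    have vs: "word_val (ss @ [s]) = word_val ss \<otimes> s" using S by (simp add: word_val_append)
    have "length ss = len (word_val ss)"
      using snoc.prems(2) len_mult_le[of "word_val ss" s] len_gen[of s] len_word_val_le[of ss] S vs
      by simp
    then have IH: "len (w \<otimes> word_val ss) = len w + length ss" using snoc.IH I by simp
    let ?x = "w \<otimes> word_val ss"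
    \<comment> \<open>The reflection acting on \<open>?x\<close> from the left as \<open>s\<close>
      acts from the right, so that strong exchange applies.\<close>
    let ?t = "?x \<otimes> s \<otimes> inv ?x"
    have x: "?x \<in> carrier W" using w S by simp
    have t: "?t \<in> reflections W S" using S x by (simp add: gen_reflection reflection_conj)
    have tx: "?t \<otimes> ?x = ?x \<otimes> s" using x S by (simp add: m_assoc)
    have "\<not> len (?t \<otimes> ?x) < len ?x"
    proof
      assume "len (?t \<otimes> ?x) < len ?x"
      then have "len (?t \<otimes> word_val (us @ ss)) < len (word_val (us @ ss))"
        using us S by (simp add: word_val_append)
      then obtain xs a ys where ex: "us @ ss = xs @ a # ys"
        "?t \<otimes> word_val (us @ ss) = word_val (xs @ ys)"
        using strong_exchange[of "us @ ss" ?t] us S t by auto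
      have val: "word_val (us @ ss) = ?x" using us S by (simp add: word_val_append)
      from ex(1) consider zs where "us = xs @ a # zs" "ys = zs @ ss"
        | zs where "ss = zs @ a # ys" "xs = us @ zs"
        by (auto simp: append_eq_append_conv2 append_eq_Cons_conv Cons_eq_append_conv)
      then show False
      proof cases
        \<comment> \<open>A deletion in \<open>us\<close> produces the element \<open>w ?v\<close>
          of \<open>w P\<close>, shorter than \<open>w\<close>.\<close>
        case 1
        let ?v = "word_val ss \<otimes> s \<otimes> inv (word_val ss)"
        have zs: "xs \<in> lists S" "zs \<in> lists S" using 1 us by auto
        have "word_val (xs @ zs) \<otimes> word_val ss = ?x \<otimes> s"
          using ex(2) 1 zs S unfolding val tx by (simp add: word_val_append m_assoc)
        then have "word_val (xs @ zs) = ?x \<otimes> s \<otimes> inv (word_val ss)"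
          using zs S by (intro eq_mult_inv) auto
        then have "word_val (xs @ zs) = w \<otimes> ?v" using w S by (simp add: m_assoc)
        moreover have "?v \<in> P" using I word_val_in_P by simp
        ultimately have "len w \<le> len (word_val (xs @ zs))" using shortest by simp
        also have "\<dots> < len w" using len_word_val_le[of "xs @ zs"] zs 1 us(3) by simp
        finally show False by simp
      next
        \<comment> \<open>A deletion in \<open>ss\<close> leaves fewer than \<open>length ss\<close>
          letters for the value of \<open>ss @ [s]\<close>, which is reduced.\<close>
        case 2
        have zs: "zs \<in> lists S" "ys \<in> lists S" using 2 S by auto
        have "w \<otimes> (word_val ss \<otimes> s) = w \<otimes> word_val (zs @ ys)"
          using ex(2) 2 zs S us w unfolding val tx by (simp add: word_val_append m_assoc)
        then have "word_val ss \<otimes> s = word_val (zs @ ys)" using w zs S by simp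
        then show False using len_word_val_le[of "zs @ ys"] zs 2 snoc.prems(2) vs by simp
      qed
    qed
    then have "len (?x \<otimes> s) > len ?x"
      using len_reflection_mult_neq[OF t x] tx by simp
    moreover have "len (?x \<otimes> s) \<le> len ?x + 1" using len_mult_le[of ?x s] x S by (simp add: len_gen)
    ultimately show ?case using IH w S vs by (simp add: m_assoc)
  qed (use w in simp)
  show ?thesis unfolding min_rep_def
  proof (intro conjI ballI)
    fix v assume "v \<in> P"
    then obtain ss where "ss \<in> lists I" "word_val ss = v" "length ss = len v" by (rule reduced_word_P)
    then show "len (w \<otimes> v) = len w + len v" using add[of ss] by simp
  qed (rule w)
qed

lemma min_rep_decomp:
  assumes g: "g \<in> carrier W"
  obtains w v where "min_rep w" "v \<in> P" "g = w \<otimes> v"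
proof -
  let ?Q = "\<lambda>w. w \<in> carrier W \<and> (\<exists>v\<in>P. g = w \<otimes> v)"
  have "?Q g" using g generate.one[of W I] by (auto intro!: bexI[of _ \<one>])
  then obtain w where w: "?Q w" and least: "\<And>x. ?Q x \<Longrightarrow> len w \<le> len x"
    using ex_has_least_nat[of ?Q g len] by blast
  then obtain v where v: "v \<in> P" "g = w \<otimes> v" by auto
  have "min_rep w"
  proof (rule shortest_imp_min_rep)
    fix u assume u: "u \<in> P"
    have "g = (w \<otimes> u) \<otimes> (inv u \<otimes> v)" using u v w by (simp add: m_assoc inv_mult_cancel)
    moreover have "inv u \<otimes> v \<in> P" using u v by simp
    ultimately show "len w \<le> len (w \<otimes> u)" using u w by (intro least) auto
  qed (use w in simp)
  then show ?thesis using v that by blast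
qed

text \<open>Deodhar's lemma.\<close>

lemma min_rep_gen_mult:
  assumes w: "min_rep w" and s: "s \<in> S" and u: "min_rep u" and v: "v \<in> P" and eq: "s \<otimes> w = u \<otimes> v"
  shows "v = \<one> \<or> v \<in> I \<and> u = w"
proof (cases "v = \<one>")
  case False
  note carr [simp] = min_repD(1)[OF w] min_repD(1)[OF u]
  have "s \<otimes> u \<otimes> v = w" using eq s w u v by (simp add: m_assoc gen_cancel flip: eq)
  then have su: "s \<otimes> u = w \<otimes> inv v" using s v by (intro eq_mult_inv) auto
  \<comment> \<open>The equations \<open>s w = u v\<close> and \<open>s u = w (inv v)\<close> bound
    the lengths from both sides; adding the bounds gives \<open>2 * len v \<le> 2\<close>.\<close>
  have "len u + len v \<le> len w + 1"
    using len_gen_mult(1)[of s w] s min_repD(2)[OF u v] by (simp add: eq)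
  moreover have "len w + len v \<le> len u + 1"
    using len_gen_mult(1)[of s u] s v min_repD(2)[OF w, of "inv v"] by (simp add: su)
  moreover have "len v \<noteq> 0" using False v len_eq_0_iff by simp
  ultimately have lens: "len v = 1" "len u = len w" by auto
  obtain ss where "ss \<in> lists I" "word_val ss = v" "length ss = 1"
    using reduced_word_P[OF v] lens(1) by metis
  then have vI: "v \<in> I" using subset_gens by (auto simp: length_Suc_conv)
  then have vS: "v \<in> S" using subset_gens by auto
  obtain us where us: "us \<in> lists S" "word_val us = u" "length us = len u"
    using reduced_word[of u] by auto
  have val: "word_val (us @ [v]) = u \<otimes> v" using us vS by (simp add: word_val_append)
  have ssw: "s \<otimes> (u \<otimes> v) = w" using s by (simp add: gen_cancel flip: eq)
  have "len (s \<otimes> word_val (us @ [v])) < len (word_val (us @ [v]))"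
    unfolding val ssw using min_repD(2)[OF u v] lens by simp
  then obtain xs a ys where ex: "us @ [v] = xs @ a # ys" "w = word_val (xs @ ys)"
    using strong_exchange[of "us @ [v]" s] us vS gen_reflection[OF s] unfolding val ssw by auto
  \<comment> \<open>If exchange deletes the last letter \<open>v\<close>, then \<open>w = u\<close>.
    If it deletes a letter of \<open>us\<close>, then \<open>w v\<close> is shorter than
    \<open>w\<close>, against additivity.\<close>
  show ?thesis
  proof (cases ys rule: rev_cases)
    case Nil
    then show ?thesis using ex us vI by simp
  next
    case (snoc zs b)
    then have zs: "us = xs @ a # zs" "b = v" using ex(1) by auto
    have S: "xs \<in> lists S" "zs \<in> lists S" using us zs by auto
    have "w \<otimes> v = word_val (xs @ zs)"
      using ex(2) S snoc zs vS by (simp add: word_val_append m_assoc gen_square)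
    then have "len (w \<otimes> v) \<le> length (xs @ zs)" using len_word_val_le[of "xs @ zs"] S by simp
    also have "\<dots> < len w" using us(3) zs lens by simp
    finally show ?thesis using min_repD(2)[OF w v] by simp
  qed
qed simp

text \<open>Exchange in a word for \<open>w' v\<close> cannot delete a letter of \<open>v\<close>:
  that would put \<open>w\<close> in \<open>w' P\<close> and the conjugate of \<open>r\<close> in
  \<open>P\<close>. Deleting a letter of \<open>w'\<close> spells \<open>w (inv v)\<close> with
  \<open>len w' - 1\<close> letters, and additivity gives the bound.\<close>

lemma min_rep_reflection_longer:
  assumes r: "r \<in> reflections W S" and w: "min_rep w" and w': "min_rep w'" and v: "v \<in> P"
    and eq: "r \<otimes> w = w' \<otimes> v" and out: "inv w \<otimes> r \<otimes> w \<notin> P" and longer: "len w < len (r \<otimes> w)"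
  shows "len w + len v < len w'"
proof -
  note carr [simp] = min_repD(1)[OF w] min_repD(1)[OF w']
  obtain us where us: "us \<in> lists S" "word_val us = w'" "length us = len w'"
    using reduced_word[of w'] by auto
  obtain vs where vs: "vs \<in> lists I" "word_val vs = v" "length vs = len v"
    using v by (rule reduced_word_P)
  have vsS: "vs \<in> lists S" using vs I_lists by auto
  have val: "word_val (us @ vs) = r \<otimes> w" using us vs vsS eq by (simp add: word_val_append)
  have rr: "r \<otimes> word_val (us @ vs) = w" using r by (simp add: val reflection_cancel)
  have "len (r \<otimes> word_val (us @ vs)) < len (word_val (us @ vs))"
    using longer r by (simp add: val reflection_cancel)
  then obtain xs a ys where ex: "us @ vs = xs @ a # ys" "w = word_val (xs @ ys)"
    using strong_exchange[of "us @ vs" r] us vsS r unfolding rr by auto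
  from ex(1) consider zs where "us = xs @ a # zs" "ys = zs @ vs"
    | zs where "vs = zs @ a # ys" "xs = us @ zs"
    by (auto simp: append_eq_append_conv2 append_eq_Cons_conv Cons_eq_append_conv)
  then show ?thesis
  proof cases
    case 1
    have S: "xs \<in> lists S" "zs \<in> lists S" using us 1 by auto
    have "w = word_val (xs @ zs) \<otimes> v" using ex(2) 1 S v vs vsS by (simp add: word_val_append m_assoc)
    then have "w \<otimes> inv v = word_val (xs @ zs)" using v S by (simp add: m_assoc)
    then have "len w + len v \<le> length (xs @ zs)"
      using min_repD(2)[OF w, of "inv v"] v S len_word_val_le[of "xs @ zs"] by simp
    then show ?thesis using us(3) 1 by simp
  next
    case 2
    have I: "zs \<in> lists I" "ys \<in> lists I" using vs 2 by auto
    let ?u = "word_val (zs @ ys)"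
    have u: "?u \<in> P" using I word_val_in_P by simp
    have "w = w' \<otimes> ?u" using ex(2) 2 us I I_lists by (simp add: word_val_append m_assoc)
    then have "inv w \<otimes> r \<otimes> w = inv ?u \<otimes> v"
      using eq r u v by (simp add: m_assoc inv_mult_group inv_mult_cancel)
    then show ?thesis using out u v by simp
  qed
qed

text \<open>If \<open>r\<close> shortens \<open>w\<close>, the roles of \<open>w\<close> and
  \<open>w'\<close> are exchanged through \<open>r w' = w (inv v)\<close>.\<close>

lemma min_rep_reflection:
  assumes r: "r \<in> reflections W S" and w: "min_rep w" and w': "min_rep w'" and v: "v \<in> P"
    and eq: "r \<otimes> w = w' \<otimes> v" and out: "inv w \<otimes> r \<otimes> w \<notin> P"
  shows "len w + len v < len w' \<or> len w' + len v < len w"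
proof (cases "len w < len (r \<otimes> w)")
  case True
  then show ?thesis using min_rep_reflection_longer assms by blast
next
  case False
  note carr [simp] = min_repD(1)[OF w] min_repD(1)[OF w']
  have "len (r \<otimes> w) \<noteq> len w" using len_reflection_mult_neq[OF r] by simp
  then have "len (r \<otimes> w) < len w" using False by simp
  then have less: "len w' < len w" using min_repD(2)[OF w' v] eq by simp
  have "r \<otimes> w' \<otimes> v = w" using r v eq by (simp add: m_assoc reflection_cancel flip: eq)
  then have eq': "r \<otimes> w' = w \<otimes> inv v" using r v by (intro eq_mult_inv) auto
  \<comment> \<open>The conjugates of \<open>r\<close> by \<open>w\<close> and by \<open>w'\<close>
    differ by conjugation with \<open>v\<close>, which preserves \<open>P\<close>.\<close>
  have "inv w' \<otimes> r \<otimes> w' \<notin> P"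
  proof
    assume "inv w' \<otimes> r \<otimes> w' \<in> P"
    moreover have "w' = r \<otimes> w \<otimes> inv v" using eq v r by (simp add: m_assoc)
    then have "inv v \<otimes> (inv w' \<otimes> r \<otimes> w') \<otimes> v = inv w \<otimes> r \<otimes> w"
      using r v by (simp add: m_assoc inv_mult_group inv_mult_cancel reflection_inv reflection_cancel)
    ultimately show False using out v by (metis P_inv P_mult)
  qed
  moreover have "len w' < len (r \<otimes> w')" using less min_repD(2)[OF w, of "inv v"] v eq' by simp
  ultimately show ?thesis
    using min_rep_reflection_longer[OF r w' w _ eq'] v by simp
qed

section \<open>Heights of cosets\<close>

context
  fixes H
  assumes H: "subgroup H W" and H_sub: "H \<subseteq> P"
begin

abbreviation h where "h \<equiv> coset_length W S H"

lemma coset_length_attained: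
  obtains k where "k \<in> H" "k \<in> carrier W" "len (g \<otimes> k) = h g"
proof -
  have "\<exists>n. \<exists>k\<in>H. len (g \<otimes> k) = n" using subgroup.one_closed[OF H] by auto
  from LeastI_ex[OF this] show ?thesis
    using that subgroup.mem_carrier[OF H] unfolding coset_length_def by blast
qed

lemma coset_length_le: "k \<in> H \<Longrightarrow> h g \<le> len (g \<otimes> k)"
  unfolding coset_length_def by (rule Least_le) auto

lemma coset_length_mult_le:
  assumes "a \<in> carrier W" "g \<in> carrier W"
  shows "h (a \<otimes> g) \<le> len a + h g"
proof -
  obtain k where k: "k \<in> H" "k \<in> carrier W" "len (g \<otimes> k) = h g"
    by (rule coset_length_attained)
  then have "h (a \<otimes> g) \<le> len (a \<otimes> (g \<otimes> k))" using coset_length_le[of k "a \<otimes> g"] assms by (simp add: m_assoc)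
  also have "\<dots> \<le> len a + len (g \<otimes> k)" using len_mult_le[of a "g \<otimes> k"] assms k(2) by simp
  finally show ?thesis using k by simp
qed

lemma coset_length_le_mult:
  assumes "a \<in> carrier W" "g \<in> carrier W"
  shows "h g \<le> len a + h (a \<otimes> g)"
  using coset_length_mult_le[of "inv a" "a \<otimes> g"] assms by (simp add: inv_mult_cancel)

text \<open>All of \<open>aH\<close> lies in \<open>P\<close>, so \<open>w\<close> adds
  \<open>len w\<close> to every length over which the minimum is taken.\<close>

lemma coset_length_min_rep:
  assumes w: "min_rep w" and a: "a \<in> P"
  shows "h (w \<otimes> a) = len w + h a"
proof (rule antisym)
  show "h (w \<otimes> a) \<le> len w + h a"
    using coset_length_mult_le[of w a] min_repD[OF w] a by simp
  obtain k where k: "k \<in> H" "k \<in> carrier W" "len (w \<otimes> a \<otimes> k) = h (w \<otimes> a)"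
    by (rule coset_length_attained)
  then have "a \<otimes> k \<in> P" using a H_sub by auto
  then have "h (w \<otimes> a) = len w + len (a \<otimes> k)"
    using k a min_repD[OF w] by (simp add: m_assoc)
  then show "len w + h a \<le> h (w \<otimes> a)" using coset_length_le[OF k(1), of a] by simp
qed

text \<open>Multiplication by \<open>v\<close> changes \<open>h\<close> by at most
  \<open>len v\<close>, too little to offset the gap between \<open>len w\<close> and
  \<open>len w'\<close>.\<close>

lemma coset_length_reflection:
  assumes r: "r \<in> reflections W S" and w: "min_rep w" and w': "min_rep w'" and v: "v \<in> P"
    and eq: "r \<otimes> w = w' \<otimes> v" and out: "inv w \<otimes> r \<otimes> w \<notin> P" and a: "a \<in> P"
  shows "len w + len v < len w' \<and> h (w \<otimes> a) < h (r \<otimes> (w \<otimes> a)) \<or>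
    len w' + len v < len w \<and> h (r \<otimes> (w \<otimes> a)) < h (w \<otimes> a)"
proof -
  have "r \<otimes> (w \<otimes> a) = w' \<otimes> (v \<otimes> a)"
    using eq r v a min_repD(1)[OF w] min_repD(1)[OF w'] by (metis m_assoc P_carrier reflection_closed)
  then have "h (r \<otimes> (w \<otimes> a)) = len w' + h (v \<otimes> a)" "h (w \<otimes> a) = len w + h a"
    using coset_length_min_rep w w' v a by simp_all
  then show ?thesis
    using min_rep_reflection[OF r w w' v eq out] coset_length_mult_le[of v a]
      coset_length_le_mult[of v a] v a by auto
qed

lemma l_coset_mult_cong:
  assumes "w \<in> carrier W" "a \<in> carrier W" "b \<in> carrier W" "a <# H = b <# H"
  shows "(w \<otimes> a) <# H = (w \<otimes> b) <# H"
  using assms by (metis H lcos_m_assoc subgroup.subset)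

text \<open>The premises are the two axioms for \<open>P / H\<close>, phrased with lengths and
  reflections of \<open>W\<close>, so that concrete subgroups of \<open>P\<close> can be checked
  without passing to the parabolic Coxeter system.\<close>

lemma quasiparabolic_from_parabolic:
  assumes qp1: "\<And>r a. \<lbrakk>r \<in> reflections W S; r \<in> P; a \<in> P; h (r \<otimes> a) = h a\<rbrakk> \<Longrightarrow>
      (r \<otimes> a) <# H = a <# H"
    and qp2: "\<And>r a s. \<lbrakk>r \<in> reflections W S; r \<in> P; a \<in> P; s \<in> I; h a < h (r \<otimes> a);
      h (s \<otimes> (r \<otimes> a)) < h (s \<otimes> a)\<rbrakk> \<Longrightarrow> (r \<otimes> a) <# H = (s \<otimes> a) <# H"
  shows "quasiparabolic_subgroup W S H"
  unfolding quasiparabolic_subgroup_iff[OF H gens_carrier]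
proof (intro conjI ballI impI)
  fix s g assume s: "s \<in> S" and g: "g \<in> carrier W"
  show "\<bar>int (h (s \<otimes> g)) - int (h g)\<bar> \<le> 1"
    using coset_length_mult_le[of s g] coset_length_le_mult[of s g] s g by (simp add: len_gen)
next
  fix r g assume r: "r \<in> reflections W S" and g: "g \<in> carrier W" and hr: "h (r \<otimes> g) = h g"
  obtain w a where w: "min_rep w" and a: "a \<in> P" and ga: "g = w \<otimes> a"
    using g by (rule min_rep_decomp)
  note carr [simp] = min_repD(1)[OF w]
  obtain w' v where w': "min_rep w'" and v: "v \<in> P" and eq: "r \<otimes> w = w' \<otimes> v"
    using r by (auto intro: min_rep_decomp[of "r \<otimes> w"])
  let ?r = "inv w \<otimes> r \<otimes> w"
  \<comment> \<open>Outside \<open>P\<close>, \<open>coset_length_reflection\<close> would make the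
    two heights differ.\<close>
  have in_P: "?r \<in> P" using coset_length_reflection[OF r w w' v eq _ a] hr ga by auto
  have r': "?r \<in> reflections W S" using reflection_conj[OF r, of "inv w"] by simp
  have rg: "r \<otimes> g = w \<otimes> (?r \<otimes> a)" using r a by (simp add: ga m_assoc inv_mult_cancel)
  have "h (?r \<otimes> a) = h a"
    using hr coset_length_min_rep[OF w] a in_P unfolding rg unfolding ga by simp
  then have "(?r \<otimes> a) <# H = a <# H" using qp1 r' in_P a by blast
  then show "(r \<otimes> g) <# H = g <# H"
    unfolding rg unfolding ga using a r by (intro l_coset_mult_cong) auto
next
  fix r g s assume r: "r \<in> reflections W S" and g: "g \<in> carrier W" and s: "s \<in> S"
    and hh: "h g < h (r \<otimes> g) \<and> h (s \<otimes> (r \<otimes> g)) < h (s \<otimes> g)"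
  obtain w a where w: "min_rep w" and a: "a \<in> P" and ga: "g = w \<otimes> a"
    using g by (rule min_rep_decomp)
  note carr [simp] = min_repD(1)[OF w]
  obtain u b where u: "min_rep u" and b: "b \<in> P" and sw: "s \<otimes> w = u \<otimes> b"
    using s by (auto intro: min_rep_decomp[of "s \<otimes> w"])
  note carr' [simp] = min_repD(1)[OF u]
  let ?r = "inv w \<otimes> r \<otimes> w"
  have sg: "s \<otimes> g = u \<otimes> (b \<otimes> a)" 
    using sw s a b carr carr' unfolding ga by (metis m_assoc P_carrier gen_carrier)
  show "(r \<otimes> g) <# H = (s \<otimes> g) <# H"
  proof (cases "?r \<in> P")
    case True
    have r': "?r \<in> reflections W S" using reflection_conj[OF r, of "inv w"] by simp
    have rg: "r \<otimes> g = w \<otimes> (?r \<otimes> a)" using r a by (simp add: ga m_assoc inv_mult_cancel)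
    have "s \<otimes> (r \<otimes> g) = (s \<otimes> w) \<otimes> (?r \<otimes> a)" using rg s r a by (simp add: m_assoc)
    then have srg: "s \<otimes> (r \<otimes> g) = u \<otimes> (b \<otimes> (?r \<otimes> a))"
      using True a b unfolding sw by (simp add: m_assoc)
    have less: "h a < h (?r \<otimes> a)"
      using hh coset_length_min_rep[OF w] a True unfolding rg unfolding ga by simp
    have less': "h (b \<otimes> (?r \<otimes> a)) < h (b \<otimes> a)"
      using hh coset_length_min_rep[OF u] a b True unfolding srg sg by simp
    \<comment> \<open>With \<open>b = 1\<close> the two strict inequalities contradict each other,
      so Deodhar's lemma yields \<open>s w = w b\<close> with \<open>b\<close> in \<open>I\<close>,
      and the axiom for \<open>P / H\<close> applies to \<open>b\<close>.\<close>
    have "b \<noteq> \<one>" using less less' a r by auto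
    then have bI: "b \<in> I" and uw: "u = w" using min_rep_gen_mult[OF w s u b sw] by auto
    have "(?r \<otimes> a) <# H = (b \<otimes> a) <# H" using qp2[OF r' True a bI less less'] .
    then show ?thesis unfolding rg sg uw using a b r by (intro l_coset_mult_cong) auto
  next
    case False
    obtain w' v where w': "min_rep w'" and v: "v \<in> P" and rw: "r \<otimes> w = w' \<otimes> v"
      using r by (auto intro: min_rep_decomp[of "r \<otimes> w"])
    note carr'' [simp] = min_repD(1)[OF w']
    obtain u' b' where u': "min_rep u'" and b': "b' \<in> P" and sw': "s \<otimes> w' = u' \<otimes> b'"
      using s by (auto intro: min_rep_decomp[of "s \<otimes> w'"])
    note carr''' [simp] = min_repD(1)[OF u']
    have longer: "len w + len v < len w'"
      using coset_length_reflection[OF r w w' v rw False a] hh ga by auto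
    \<comment> \<open>This reflection carries \<open>s g\<close> to \<open>s r g\<close>, so the
      second inequality of (QP2) becomes a height comparison for a single reflection.\<close>
    let ?t = "s \<otimes> r \<otimes> inv s"
    have t: "?t \<in> reflections W S" using r s by (simp add: reflection_conj)
    have u_eq: "u = s \<otimes> w \<otimes> inv b" using sw b by (simp add: m_assoc)
    have conj: "inv u \<otimes> ?t \<otimes> u = b \<otimes> ?r \<otimes> inv b"
      using s r b by (simp add: u_eq m_assoc inv_mult_group inv_mult_cancel)
    have out: "inv u \<otimes> ?t \<otimes> u \<notin> P"
    proof
      assume "inv u \<otimes> ?t \<otimes> u \<in> P"
      then have "inv b \<otimes> (b \<otimes> ?r \<otimes> inv b) \<otimes> b \<in> P" using b unfolding conj by simp
      moreover have "inv b \<otimes> (b \<otimes> ?r \<otimes> inv b) \<otimes> b = ?r"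
        using b r by (simp add: m_assoc inv_mult_cancel)
      ultimately show False using False by simp
    qed
    have "?t \<otimes> u = s \<otimes> (r \<otimes> w) \<otimes> inv b"
      using s r b by (simp add: u_eq m_assoc inv_mult_cancel)
    also have "\<dots> = (s \<otimes> w') \<otimes> (v \<otimes> inv b)" using s v b by (simp add: rw m_assoc)
    also have "\<dots> = u' \<otimes> (b' \<otimes> (v \<otimes> inv b))" using v b b' by (simp add: sw' m_assoc)
    finally have tu: "?t \<otimes> u = u' \<otimes> (b' \<otimes> (v \<otimes> inv b))" .
    have "?t \<otimes> (u \<otimes> (b \<otimes> a)) = s \<otimes> (r \<otimes> g)"
      unfolding sg[symmetric] using s r g by (simp add: m_assoc inv_mult_cancel)
    then have shorter: "len u' < len u"
      using coset_length_reflection[OF t u u' _ tu out, of "b \<otimes> a"] hh b b' v a sg by auto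
    have lu: "len u + len b \<le> len w + 1"
      using len_gen_mult(1)[OF s, of w] min_repD(2)[OF u b] by (simp add: sw)
    have u'_eq: "s \<otimes> u' = w' \<otimes> inv b'"
    proof (rule eq_mult_inv)
      show "s \<otimes> u' \<otimes> b' = w'" using s b' by (simp add: m_assoc gen_cancel flip: sw')
    qed (use s b' in auto)
    have lu': "len w' + len b' \<le> len u' + 1"
      using len_gen_mult(1)[OF s, of u'] min_repD(2)[OF w', of "inv b'"] b' by (simp add: u'_eq)
    \<comment> \<open>The four bounds close up: \<open>len w + len v + 1 \<le> len w'\<close>,
      \<open>len w' + len b' \<le> len u' + 1 \<le> len u\<close> and
      \<open>len u + len b \<le> len w + 1\<close>.\<close>
    have lens: "len u = len w + 1" "len u' = len w" "len w' = len w + 1"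
      "len v = 0" "len b = 0" "len b' = 0"
      using longer shorter lu lu' by auto
    then have ones: "v = \<one>" "b = \<one>" "b' = \<one>" using len_eq_0_iff v b b' by auto
    have rw_eq: "r \<otimes> w = w'" and sw_eq: "s \<otimes> w = u" and sw'_eq: "s \<otimes> w' = u'"
      using rw sw sw' ones by auto
    obtain us where us: "us \<in> lists S" "word_val us = u'" "length us = len u'"
      using reduced_word[of u'] by auto
    have val: "word_val (s # us) = w'" using us s by (simp add: gen_cancel flip: sw'_eq)
    have rw': "r \<otimes> w' = w" using r by (simp add: reflection_cancel flip: rw_eq)
    \<comment> \<open>The word \<open>s # us\<close> spells \<open>w'\<close>, and
      \<open>r w' = w\<close> is shorter. Deleting \<open>s\<close> gives \<open>w = u'\<close>;
      deleting a letter of \<open>us\<close> would make \<open>u = s w\<close> shorter than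
      \<open>u'\<close>, although \<open>len u = len u' + 1\<close>.\<close>
    obtain xs c ys where ex: "s # us = xs @ c # ys" "w = word_val (xs @ ys)"
      using strong_exchange[of "s # us" r] us s r lens unfolding val rw' by auto
    have "w = u'"
    proof (cases xs)
      case Nil
      then show ?thesis using ex us by simp
    next
      case (Cons d zs)
      then have ds: "d = s" "us = zs @ c # ys" using ex(1) by auto
      then have S: "zs \<in> lists S" "ys \<in> lists S" using us by auto
      have "u = word_val (zs @ ys)" using ex(2) s S sw_eq Cons ds by (simp add: gen_cancel)
      then have "len u \<le> length (zs @ ys)" using len_word_val_le[of "zs @ ys"] S by simp
      then show ?thesis using us(3) ds lens by simp
    qed
    then have "s \<otimes> w = w'" using s by (simp add: gen_cancel flip: sw'_eq)
    then have "r \<otimes> g = s \<otimes> g" using rw_eq r s a by (simp add: ga flip: m_assoc)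
    then show ?thesis by simp
  qed
qed

lemma coset_length_parabolic:
  assumes "v \<in> P"
  shows "coset_length (std_parabolic W I) I H v = h v"
proof -
  have mult: "mult (std_parabolic W I) = mult W" by (simp add: std_parabolic_def)
  have "cox_length (std_parabolic W I) I (v \<otimes> k) = len (v \<otimes> k)" if "k \<in> H" for k
    using that assms H_sub by (intro cox_length_parabolic) auto
  then show ?thesis by (simp add: coset_length_def mult cong: bex_cong)
qed

end

text \<open>Cosets and heights agree in the two groups, and every reflection of \<open>W\<close>
  lying in \<open>P\<close> is a reflection of the parabolic system, so the axioms there supply the
  premises of \<open>quasiparabolic_from_parabolic\<close>.\<close>

lemma quasiparabolic_parabolic:
  assumes "quasiparabolic_subgroup (std_parabolic W I) I H"
  shows "quasiparabolic_subgroup W S H"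
proof -
  have "group (std_parabolic W I)"
    using subgroup_imp_group[OF subgroup_P] by (simp add: std_parabolic_def)
  then interpret P: group "std_parabolic W I" .
  have H': "subgroup H (std_parabolic W I)"
    using assms by (simp add: quasiparabolic_subgroup_def)
  then have H: "subgroup H W" "H \<subseteq> P"
    using incl_subgroup[OF subgroup_P] subgroup.subset[OF H'] by (auto simp: std_parabolic_def)
  have I: "I \<subseteq> carrier (std_parabolic W I)" by (auto simp: std_parabolic_def)
  have lc: "x <#\<^bsub>std_parabolic W I\<^esub> H = x <# H" for x by (simp add: std_parabolic_def l_coset_def)
  have mult: "mult (std_parabolic W I) = mult W" "carrier (std_parabolic W I) = P"
    by (simp_all add: std_parabolic_def)
  note len_eq = coset_length_parabolic[OF H]
  note qp = assms[unfolded P.quasiparabolic_subgroup_iff[OF H' I] lc mult]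
  show ?thesis
  proof (rule quasiparabolic_from_parabolic[OF H])
    fix r a assume r: "r \<in> reflections W S" "r \<in> P" and a: "a \<in> P"
      and eq: "coset_length W S H (r \<otimes> a) = coset_length W S H a"
    have "coset_length (std_parabolic W I) I H (r \<otimes> a) = coset_length (std_parabolic W I) I H a"
      using eq len_eq r a by simp
    then show "(r \<otimes> a) <# H = a <# H" using qp reflection_parabolic[OF r] a by blast
  next
    fix r a s assume r: "r \<in> reflections W S" "r \<in> P" and a: "a \<in> P" and s: "s \<in> I"
      and less: "coset_length W S H a < coset_length W S H (r \<otimes> a)"
      "coset_length W S H (s \<otimes> (r \<otimes> a)) < coset_length W S H (s \<otimes> a)"
    have "coset_length (std_parabolic W I) I H a < coset_length (std_parabolic W I) I H (r \<otimes> a)"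
      "coset_length (std_parabolic W I) I H (s \<otimes> (r \<otimes> a)) <
        coset_length (std_parabolic W I) I H (s \<otimes> a)"
      using less len_eq r a s by simp_all
    then show "(r \<otimes> a) <# H = (s \<otimes> a) <# H" using qp reflection_parabolic[OF r] a s by blast
  qed
qed

text \<open>\<open>P / P\<close> is a single point, so both axioms are immediate.\<close>

lemma quasiparabolic_P: "quasiparabolic_subgroup W S P"
proof (rule quasiparabolic_from_parabolic[OF subgroup_P subset_refl])
  fix r a assume "r \<in> reflections W S" "r \<in> P" "a \<in> P"
  then show "(r \<otimes> a) <# P = a <# P" using subgroup_P by (intro l_coset_eqI) auto
next
  fix r a s assume "r \<in> reflections W S" "r \<in> P" "a \<in> P" "s \<in> I"
  then show "(r \<otimes> a) <# P = (s \<otimes> a) <# P" using subgroup_P by (intro l_coset_eqI) auto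
qed

text \<open>A coset in \<open>P\<close> is determined by the parity of its elements, which is also
  the parity of its height. Reflections are odd, so equal heights never occur in (QP1), while in
  (QP2) \<open>r a\<close> and \<open>s a\<close> have the same parity and hence the same
  coset.\<close>

lemma quasiparabolic_even: "quasiparabolic_subgroup W S {w \<in> P. even (len w)}"
proof -
  let ?E = "{w \<in> P. even (len w)}"
  have E: "subgroup ?E W"
  proof (rule subgroupI)
    show "?E \<subseteq> carrier W" by auto
    have "\<one> \<in> ?E" by (simp add: generate.one)
    then show "?E \<noteq> {}" by blast
    show "inv a \<in> ?E" if "a \<in> ?E" for a using that by simp
    show "a \<otimes> b \<in> ?E" if "a \<in> ?E" "b \<in> ?E" for a b using that by (simp add: even_len_mult)
  qed
  have parity: "even (coset_length W S ?E a) \<longleftrightarrow> even (len a)" if "a \<in> P" for a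
  proof -
    obtain k where "k \<in> ?E" "len (a \<otimes> k) = coset_length W S ?E a"
      using E by (rule coset_length_attained) auto
    then show ?thesis using even_len_mult[of a k] that by auto
  qed
  show ?thesis
  proof (rule quasiparabolic_from_parabolic[OF E])
    fix r a assume ra: "r \<in> reflections W S" "r \<in> P" "a \<in> P"
      "coset_length W S ?E (r \<otimes> a) = coset_length W S ?E a"
    then have "even (len (r \<otimes> a)) = even (len a)" using parity[of a] parity[of "r \<otimes> a"] by simp
    then show "(r \<otimes> a) <# ?E = a <# ?E"
      using ra odd_len_reflection by (simp add: even_len_mult)
  next
    fix r a s assume "r \<in> reflections W S" "r \<in> P" "a \<in> P" "s \<in> I"
    moreover from this have "s \<in> S" using subset_gens by auto
    ultimately show "(r \<otimes> a) <# ?E = (s \<otimes> a) <# ?E"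
      by (intro l_coset_eqI[OF E]) (auto simp: even_len_mult odd_len_reflection len_gen)
  qed auto
qed

end

theorem corollary3p7:
  fixes W :: "('a, 'b) monoid_scheme" and S I :: "'a set"
  assumes "coxeter_system W S" and "I \<subseteq> S"
  shows "(\<forall>H. quasiparabolic_subgroup (std_parabolic W I) I H \<longrightarrow>
              quasiparabolic_subgroup W S H) \<and>
         quasiparabolic_subgroup W S (carrier (std_parabolic W I)) \<and>
         quasiparabolic_subgroup W S {w \<in> carrier (std_parabolic W I). even (cox_length W S w)}"
proof -
  interpret group W using assms(1) by (simp add: coxeter_system_def)
  interpret parabolic W S I using assms by unfold_locales
  have "carrier (std_parabolic W I) = P" by (simp add: std_parabolic_def)
  then show ?thesis
    using quasiparabolic_parabolic quasiparabolic_P quasiparabolic_even by simp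
qed

end
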